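(* There exists an absolute constant $c>0$ such that for every positive integer $n$ there exists a graph $G$ with exactly $n$ vertices that is a Hasse diagram and whose chromatic number satisfies $\chi(G)\geq c\,n^{1/4}$.
   Context: Given a finite partially ordered set $(P,<)$, its Hasse diagram (cover graph) is the undirected graph on vertex set $P$ in which $x$ and $y$ are joined by an edge if $x<y$ and there is no $z\in P$ with $x<z<y$. A graph is called a Hasse diagram if it is the Hasse diagram of some finite partially ordered set. $\chi(G)$ denotes the chromatic number of $G$. *)

theory Defs
  imports Complex_Main "Graph_Theory.Pair_Digraph"
begin

text \<open>A finite simple graph is a \<open>pair_graph\<close>, that is, a finite, loop-free digraph
  without parallel arcs whose arc relation is symmetric: the edge \<open>xy\<close> is represented by the
  two arcs \<open>(x, y)\<close> and \<open>(y, x)\<close>.\<close>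

text \<open>Only the restriction of \<open>lt\<close> to \<open>P\<close> matters, here and in the definitions below.\<close>

definition finite_strict_poset :: "'a set \<Rightarrow> ('a \<Rightarrow> 'a \<Rightarrow> bool) \<Rightarrow> bool" where
  "finite_strict_poset P lt \<longleftrightarrow> finite P \<and> irreflp_on P lt \<and> transp_on P lt"

definition covered_by :: "'a set \<Rightarrow> ('a \<Rightarrow> 'a \<Rightarrow> bool) \<Rightarrow> 'a \<Rightarrow> 'a \<Rightarrow> bool" where
  "covered_by P lt x y \<longleftrightarrow>
     x \<in> P \<and> y \<in> P \<and> lt x y \<and> \<not> (\<exists>z\<in>P. lt x z \<and> lt z y)"

definition hasse_diagram :: "'a set \<Rightarrow> ('a \<Rightarrow> 'a \<Rightarrow> bool) \<Rightarrow> 'a pair_pre_digraph" where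
  "hasse_diagram P lt =
     \<lparr> pverts = P, parcs = {(x, y). covered_by P lt x y \<or> covered_by P lt y x} \<rparr>"

definition is_hasse_diagram :: "'a pair_pre_digraph \<Rightarrow> bool" where
  "is_hasse_diagram G \<longleftrightarrow>
     (\<exists>P lt. finite_strict_poset P lt \<and> G = hasse_diagram P lt)"

definition proper_colouring :: "'a pair_pre_digraph \<Rightarrow> nat \<Rightarrow> ('a \<Rightarrow> nat) \<Rightarrow> bool" where
  "proper_colouring G k f \<longleftrightarrow>
     (\<forall>v\<in>pverts G. f v < k) \<and> (\<forall>(u, v)\<in>parcs G. f u \<noteq> f v)"

text \<open>The minimum exists for every \<open>pair_graph\<close>; see \<open>chromatic_number_attained\<close>.\<close>

definition chromatic_number :: "'a pair_pre_digraph \<Rightarrow> nat" where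
  "chromatic_number G = (LEAST k. \<exists>f. proper_colouring G k f)"

lemma pair_graph_hasse_diagram:
  assumes "finite_strict_poset P lt"
  shows "pair_graph (hasse_diagram P lt)"
proof
  let ?G = "hasse_diagram P lt"
  have fin: "finite P" and irr: "irreflp_on P lt"
    using assms by (simp_all add: finite_strict_poset_def)
  have sub: "parcs ?G \<subseteq> P \<times> P"
    by (auto simp: hasse_diagram_def covered_by_def)
  have verts: "pverts ?G = P"
    by (simp add: hasse_diagram_def)
  show "fst e \<in> pverts ?G" "snd e \<in> pverts ?G" if "e \<in> parcs ?G" for e
    using that sub verts by auto
  show "finite (pverts ?G)"
    using fin verts by simp
  show "finite (parcs ?G)"
    using finite_subset[OF sub] fin by simp
  show "symmetric ?G"
    by (auto simp: hasse_diagram_def symmetric_def sym_def)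
  show "fst e \<noteq> snd e" if "e \<in> parcs ?G" for e
    using that irreflp_onD[OF irr] by (auto simp: hasse_diagram_def covered_by_def)
qed

lemma (in pair_graph) chromatic_number_attained:
  "\<exists>f. proper_colouring G (chromatic_number G) f"
proof -
  obtain f :: "'a \<Rightarrow> nat" where f: "bij_betw f (pverts G) {0..<card (pverts G)}"
    using ex_bij_betw_finite_nat[OF pair_finite_verts] by blast
  have "proper_colouring G (card (pverts G)) f"
    unfolding proper_colouring_def
  proof (intro conjI ballI)
    fix v assume "v \<in> pverts G"
    then show "f v < card (pverts G)" using bij_betwE[OF f] by auto
  next
    fix e assume e: "e \<in> parcs G"
    have "inj_on f (pverts G)" using f by (simp add: bij_betw_def)
    then have "f (fst e) \<noteq> f (snd e)"
      using arc_fst_in_verts[OF e] arc_snd_in_verts[OF e] pair_no_loops[OF e]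
      by (simp add: inj_on_eq_iff)
    then show "case e of (u, v) \<Rightarrow> f u \<noteq> f v" by (simp add: case_prod_beta)
  qed
  then have "\<exists>k f. proper_colouring G k f"
    by blast
  then show ?thesis
    unfolding chromatic_number_def by (rule LeastI_ex)
qed

end

theory Submission
  imports Defs
begin

text \<open>Let the vertices be the incidences between the points of a \<open>k \<times> 2k\<^sup>2\<close> grid and the
  \<open>k\<^sup>3\<close> lines \<open>y = ax + b\<close> with \<open>a < k\<close> and \<open>b < k\<^sup>2\<close>. Draw an arc from \<open>(p, l)\<close> to \<open>(q, m)\<close> if \<open>q\<close>
  lies on \<open>l\<close> to the right of \<open>p\<close> and \<open>m\<close> is steeper than \<open>l\<close>. The points along a directed path
  form a convex chain, so after at least two steps the path is strictly above its initial line and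
  no arc is a shortcut of a longer path: all arcs are cover relations of the order they generate.
  In an independent set every incidence \<open>(p, l)\<close> is either the leftmost one on \<open>l\<close> or the steepest
  one at \<open>p\<close>, so there are at most \<open>3k\<^sup>3\<close> of them out of \<open>k\<^sup>4\<close>.\<close>

text \<open>The triple \<open>(x, a, b)\<close> encodes the incidence of the point \<open>(x, ax + b)\<close> with the line of
  slope \<open>a\<close> and intercept \<open>b\<close>.\<close>

type_synonym incidence = "nat \<times> nat \<times> nat"

fun inc_arc :: "incidence \<Rightarrow> incidence \<Rightarrow> bool" where
  "inc_arc (x, a, b) (x', a', b') \<longleftrightarrow> x < x' \<and> a < a' \<and> a * x' + b = a' * x' + b'"

text \<open>The invariant of directed paths: unlike \<open>inc_arc\<close>, it is preserved when an
  arc is prepended.\<close>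

fun weakly_above :: "incidence \<Rightarrow> incidence \<Rightarrow> bool" where
  "weakly_above (x, a, b) (x', a', b') \<longleftrightarrow> x < x' \<and> a < a' \<and> a * x' + b \<le> a' * x' + b'"

fun strictly_above :: "incidence \<Rightarrow> incidence \<Rightarrow> bool" where
  "strictly_above (x, a, b) (x', a', b') \<longleftrightarrow> a * x' + b < a' * x' + b'"

lemma inc_arc_imp_weakly_above: "inc_arc u v \<Longrightarrow> weakly_above u v"
  by (cases u; cases v) auto

lemma strictly_above_imp_not_inc_arc: "strictly_above u v \<Longrightarrow> \<not> inc_arc u v"
  by (cases u; cases v) auto

text \<open>The lines of \<open>u\<close> and \<open>w\<close> meet at the point of
  \<open>w\<close>. To the right of it the steeper line of \<open>w\<close> runs strictly above that
  of \<open>u\<close>, and the point of \<open>v\<close> is on or above the line of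
  \<open>w\<close>.\<close>

lemma inc_arc_weakly_above:
  assumes "inc_arc u w" "weakly_above w v"
  shows "weakly_above u v \<and> strictly_above u v"
proof -
  obtain x a b where u: "u = (x, a, b)" by (cases u)
  obtain x' a' b' where w: "w = (x', a', b')" by (cases w)
  obtain x'' a'' b'' where v: "v = (x'', a'', b'')" by (cases v)
  have arc: "x < x'" "a < a'" "a * x' + b = a' * x' + b'"
    using assms(1) by (simp_all add: u w)
  have above: "x' < x''" "a' < a''" "a' * x'' + b' \<le> a'' * x'' + b''"
    using assms(2) by (simp_all add: w v)
  define d where "d = x'' - x'"
  have d: "x'' = x' + d" "d > 0" using above(1) by (simp_all add: d_def)
  have "a * d < a' * d" using arc(2) d(2) by simp
  then have "a * x'' + b < a' * x'' + b'"
    using arc(3) by (simp only: d(1) distrib_left)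
  then have "a * x'' + b < a'' * x'' + b''" using above(3) by linarith
  then show ?thesis
    using arc above by (simp add: u v)
qed

lemma tranclp_inc_arc_weakly_above:
  assumes "inc_arc\<^sup>+\<^sup>+ u v"
  shows "weakly_above u v"
  using assms
  by (induction rule: converse_tranclp_induct)
    (auto dest: inc_arc_imp_weakly_above inc_arc_weakly_above)

text \<open>Splitting off the first arc of the path puts \<open>v\<close> strictly above the line of
  \<open>u\<close>, whereas an arc would put it on that line.\<close>

lemma inc_arc_no_shortcut:
  assumes "inc_arc\<^sup>+\<^sup>+ u z" "inc_arc\<^sup>+\<^sup>+ z v"
  shows "\<not> inc_arc u v"
proof -
  obtain w where "inc_arc u w" "inc_arc\<^sup>+\<^sup>+ w v"
    using assms by (meson rtranclp_tranclp_tranclp tranclpD)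
  then show ?thesis
    using inc_arc_weakly_above tranclp_inc_arc_weakly_above strictly_above_imp_not_inc_arc
    by blast
qed

lemma tranclp_inc_arc_irrefl: "\<not> inc_arc\<^sup>+\<^sup>+ u u"
  using tranclp_inc_arc_weakly_above[of u u] by (cases u) auto

lemma card_independent_incidences:
  assumes S: "S \<subseteq> {..<k} \<times> {..<k} \<times> {..<k\<^sup>2}"
    and indep: "\<And>u v. u \<in> S \<Longrightarrow> v \<in> S \<Longrightarrow> \<not> inc_arc u v"
  shows "card S \<le> 3 * k ^ 3"
proof -
  define L where "L = {(x, a, b) \<in> S. \<forall>x'. (x', a, b) \<in> S \<longrightarrow> x \<le> x'}"
  define T where
    "T = {(x, a, b) \<in> S. \<forall>a' b'. (x, a', b') \<in> S \<longrightarrow> a' * x + b' = a * x + b \<longrightarrow> a' \<le> a}"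
  have "S \<subseteq> L \<union> T"
  proof (clarify, rule ccontr)
    fix x a b assume v: "(x, a, b) \<in> S" "(x, a, b) \<notin> T" "(x, a, b) \<notin> L"
    obtain x' where "(x', a, b) \<in> S" "x' < x"
      using v unfolding L_def by auto
    moreover obtain a' b' where "(x, a', b') \<in> S" "a' * x + b' = a * x + b" "a < a'"
      using v unfolding T_def by auto
    \<comment> \<open>The arc joins the two witnesses: it runs along the line \<open>(a, b)\<close>
      to the point of the bad incidence and turns there onto a steeper line.\<close>
    ultimately show False
      using indep[of "(x', a, b)" "(x, a', b')"] by simp
  qed
  have "inj_on snd L"
    unfolding L_def by (auto simp: inj_on_def intro: antisym)
  moreover have "snd ` L \<subseteq> {..<k} \<times> {..<k\<^sup>2}"
    using S unfolding L_def by auto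
  ultimately have "card L \<le> card ({..<k} \<times> {..<k\<^sup>2})"
    by (intro card_inj_on_le) auto
  then have L: "card L \<le> k ^ 3"
    by (simp add: power2_eq_square power3_eq_cube)
  \<comment> \<open>Only one incidence at each point is steepest, so \<open>T\<close> is counted by
    its points.\<close>
  let ?p = "\<lambda>(x, a, b). (x, a * x + b)"
  have "inj_on ?p T"
  proof (rule inj_onI)
    fix u v assume uv: "u \<in> T" "v \<in> T" "?p u = ?p v"
    obtain x a b where u: "u = (x, a, b)" by (cases u)
    obtain a' b' where v: "v = (x, a', b')" using uv(3) by (cases v) (simp add: u)
    have "a \<le> a'" "a' \<le> a" using uv unfolding T_def by (auto simp: u v)
    then show "u = v" using uv(3) by (simp add: u v)
  qed
  moreover have "?p ` T \<subseteq> {..<k} \<times> {..<2 * k\<^sup>2}"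
  proof (rule image_subsetI)
    fix v assume "v \<in> T"
    then obtain x a b where v: "v = (x, a, b)" and "x < k" "a < k" "b < k\<^sup>2"
      using S unfolding T_def by auto
    moreover from this have "a * x \<le> k\<^sup>2"
      unfolding power2_eq_square by (intro mult_mono) auto
    ultimately show "?p v \<in> {..<k} \<times> {..<2 * k\<^sup>2}" by simp
  qed
  ultimately have "card T \<le> card ({..<k} \<times> {..<2 * k\<^sup>2})"
    by (intro card_inj_on_le) auto
  then have T: "card T \<le> 2 * k ^ 3"
    by (simp add: power2_eq_square power3_eq_cube)
  have "finite (L \<union> T)"
    by (rule finite_subset[of _ "{..<k} \<times> {..<k} \<times> {..<k\<^sup>2}"])
      (use S in \<open>auto simp: L_def T_def\<close>)
  then have "card S \<le> card (L \<union> T)"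
    using \<open>S \<subseteq> L \<union> T\<close> by (rule card_mono)
  also have "\<dots> \<le> card L + card T" by (rule card_Un_le)
  finally show ?thesis using L T by linarith
qed

text \<open>Base-\<open>k\<close> digits with an unbounded last one, so that numbers from
  \<open>k ^ 4\<close> on also decode to incidences and can pad the poset to any size.\<close>

definition decode :: "nat \<Rightarrow> nat \<Rightarrow> incidence" where
  "decode k v = (v mod k, v div k mod k, v div k div k)"

lemma inj_decode: "inj (decode k)"
proof (rule injI)
  fix u v assume "decode k u = decode k v"
  then have "u mod k = v mod k" "u div k mod k = v div k mod k" "u div k div k = v div k div k"
    by (simp_all add: decode_def)
  then show "u = v" by (metis div_mult_mod_eq)
qed

lemma decode_mem:
  assumes "v < k ^ 4"
  shows "decode k v \<in> {..<k} \<times> {..<k} \<times> {..<k\<^sup>2}"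
proof -
  have "k > 0" using assms by (cases k) auto
  moreover have "v div k div k < k\<^sup>2"
    using assms by (simp add: div_mult2_eq[symmetric] less_mult_imp_div_less
        power2_eq_square power4_eq_xxxx mult.assoc)
  ultimately show ?thesis by (simp add: decode_def)
qed

definition incidence_order :: "nat \<Rightarrow> nat \<Rightarrow> nat \<Rightarrow> bool" where
  "incidence_order k u v \<longleftrightarrow> inc_arc\<^sup>+\<^sup>+ (decode k u) (decode k v)"

lemma finite_strict_poset_incidence_order: "finite_strict_poset {..<n} (incidence_order k)"
  unfolding finite_strict_poset_def incidence_order_def
  by (auto intro!: irreflp_onI transp_onI simp: tranclp_inc_arc_irrefl)

text \<open>The padding destroys no cover, since \<open>inc_arc_no_shortcut\<close> holds for
  arbitrary incidences.\<close>

lemma covered_by_incidence_order: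
  assumes "u < n" "v < n" "inc_arc (decode k u) (decode k v)"
  shows "covered_by {..<n} (incidence_order k) u v"
  using assms inc_arc_no_shortcut unfolding covered_by_def incidence_order_def by blast

text \<open>Pigeonhole: arcs are edges, so each colour class has at most \<open>3 * k ^ 3\<close> of
  the first \<open>k ^ 4\<close> vertices.\<close>

lemma colours_of_incidence_order:
  assumes "k ^ 4 \<le> n" and col: "proper_colouring (hasse_diagram {..<n} (incidence_order k)) q f"
  shows "k \<le> 3 * q"
proof -
  let ?C = "\<lambda>i. {v. v < k ^ 4 \<and> f v = i}"
  have class_le: "card (?C i) \<le> 3 * k ^ 3" for i
  proof -
    have "card (decode k ` ?C i) \<le> 3 * k ^ 3"
    proof (rule card_independent_incidences)
      show "decode k ` ?C i \<subseteq> {..<k} \<times> {..<k} \<times> {..<k\<^sup>2}"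
        using decode_mem by blast
    next
      fix s t assume "s \<in> decode k ` ?C i" "t \<in> decode k ` ?C i"
      then obtain u v where uv: "s = decode k u" "t = decode k v" "u < n" "v < n" "f u = f v"
        using \<open>k ^ 4 \<le> n\<close> by auto
      then show "\<not> inc_arc s t"
        using covered_by_incidence_order[of u n v k] col
        by (auto simp: proper_colouring_def hasse_diagram_def)
    qed
    then show ?thesis
      by (simp add: card_image inj_on_subset[OF inj_decode])
  qed
  have "{..<k ^ 4} \<subseteq> (\<Union>i<q. ?C i)"
    using col \<open>k ^ 4 \<le> n\<close> by (auto simp: proper_colouring_def hasse_diagram_def)
  then have "card {..<k ^ 4} \<le> card (\<Union>i<q. ?C i)"
    by (intro card_mono) auto
  also have "\<dots> \<le> (\<Sum>i<q. card (?C i))"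
    by (rule card_UN_le) simp
  also have "\<dots> \<le> (\<Sum>i<q. 3 * k ^ 3)"
    by (intro sum_mono class_le)
  finally have "k ^ 3 * k \<le> k ^ 3 * (3 * q)"
    by (simp add: power4_eq_xxxx power3_eq_cube algebra_simps)
  then show ?thesis by (cases "k = 0") auto
qed

theorem theorem1:
  shows "\<exists>c::real. c > 0 \<and>
    (\<forall>n::nat. n \<ge> 1 \<longrightarrow>
      (\<exists>G :: nat pair_pre_digraph.
         pair_graph G \<and> card (pverts G) = n \<and> is_hasse_diagram G \<and>
         real (chromatic_number G) \<ge> c * real n powr (1 / 4)))"
proof (intro exI[of _ "1 / 6"] conjI allI impI)
  fix n :: nat assume "n \<ge> 1"
  define r where "r = real n powr (1 / 4)"
  define k where "k = nat \<lfloor>r\<rfloor>"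
  have "r \<ge> 1" using \<open>n \<ge> 1\<close> by (simp add: r_def ge_one_powr_ge_zero)
  then have k: "real k \<le> r" "r < real k + 1" "k \<ge> 1"
    unfolding k_def by (linarith, linarith, simp add: le_nat_iff)
  have "real k ^ 4 \<le> r ^ 4" using k(1) by (intro power_mono) auto
  also have "\<dots> = real n"
    using \<open>n \<ge> 1\<close> by (simp add: r_def powr_realpow[symmetric] powr_powr)
  finally have kn: "k ^ 4 \<le> n" by (metis of_nat_le_iff of_nat_power)
  define G where "G = hasse_diagram {..<n} (incidence_order k)"
  have pg: "pair_graph G"
    unfolding G_def by (intro pair_graph_hasse_diagram finite_strict_poset_incidence_order)
  obtain f where "proper_colouring G (chromatic_number G) f"
    using pair_graph.chromatic_number_attained[OF pg] by blast
  then have "k \<le> 3 * chromatic_number G"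
    using colours_of_incidence_order[OF kn] by (simp add: G_def)
  \<comment> \<open>Since \<open>k \<ge> 1\<close>, rounding costs at most a factor 2:
    \<open>r < k + 1 \<le> 2 * k\<close>, and \<open>k\<close> is at most three times the chromatic
    number.\<close>
  then have "1 / 6 * r \<le> real (chromatic_number G)" using k by linarith
  moreover have "card (pverts G) = n" by (simp add: G_def hasse_diagram_def)
  moreover have "is_hasse_diagram G"
    unfolding is_hasse_diagram_def G_def using finite_strict_poset_incidence_order by blast
  ultimately show "\<exists>G :: nat pair_pre_digraph.
      pair_graph G \<and> card (pverts G) = n \<and> is_hasse_diagram G \<and>
      real (chromatic_number G) \<ge> 1 / 6 * real n powr (1 / 4)"
    using pg unfolding r_def by blast
qed simp

end
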